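(* Let $p$ be a prime and let $n$ be a positive integer. Then $$\zeta_{p,q,0}(n)=\frac{1}{(p-1)n}\left(\beta_{(p-1)n}(q)-[p]^{(p-1)n-1}\,\beta_{(p-1)n}(q^{p})\right).$$
   Context: Let $\mathbb{C}_p$ be the completion of an algebraic closure of $\mathbb{Q}_p$, with $|p|_p=1/p$. Fix $q\in\mathbb{C}_p$, $q\neq 1$, with $|q-1|_p<p^{-1/(p-1)}$; $q^x=\exp(x\log q)$ for $|x|_p\le 1$, and $[x]=[x:q]=\frac{1-q^x}{1-q}$. For a uniformly (strictly) differentiable function $g:\mathbb{Z}_p\to\mathbb{C}_p$ the $q$-Volkenborn integral is $$\int_{\mathbb{Z}_p}g(x)\,d\mu_q(x)=\lim_{N\to\infty}\frac{1}{[p^N]}\sum_{0\le i<p^N}q^{i}g(i).$$ Let $\mathbb{T}_p=\mathbb{Z}_p\setminus p\mathbb{Z}_p$, and let $\int_{\mathbb{T}_p}g\,d\mu_q=\lim_{N\to\infty}\frac{1}{[p^N]}\sum_{0\le i<p^N,\ p\nmid i}q^{i}g(i)$; equivalently, $\int_{\mathbb{T}_p}g(x)\,d\mu_q(x)=\int_{\mathbb{Z}_p}g(x)\,d\mu_q(x)-\frac{1}{[p]}\int_{\mathbb{Z}_p}g(px)\,d\mu_{q^p}(x)$. The $p$-adic $q$-Bernoulli numbers are $\beta_n(q)=\int_{\mathbb{Z}_p}q^{-x}[x]^n\,d\mu_q(x)$ for $n\ge0$; $\beta_n(q^p)$ is the same quantity with $q$ replaced by $q^p$ (so $[x]$ becomes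 $[x:q^p]=\frac{1-q^{px}}{1-q^p}$). The $p$-adic $q$-zeta function $\zeta_{p,q,0}$ is $$\zeta_{p,q,0}(s)=\frac{1}{(p-1)s}\int_{\mathbb{T}_p}q^{-x}[x]^{(p-1)s}\,d\mu_q(x),\qquad s\ne0;$$ at a positive integer $s=n$, $[x]^{(p-1)s}$ is the ordinary power $[x]^{(p-1)n}$. *)

theory Defs
  imports "HOL-Analysis.Analysis" "HOL-Computational_Algebra.Computational_Algebra"
begin

text \<open>
  The classes \<open>real_normed_field\<close> and \<open>banach\<close> force an Archimedean norm, so complete
  non-Archimedean fields need a class and an absolute value of their own. The class extends
  \<^class>\<open>complete_space\<close>, hence \<^const>\<open>lim\<close>, \<^const>\<open>suminf\<close> and \<^const>\<open>closure\<close> below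
  refer to the metric \<open>absv (x - y)\<close>.
\<close>

class complete_nonarch_field = field_char_0 + complete_space +
  fixes absv :: "'a \<Rightarrow> real"
  assumes dist_absv: "dist x y = absv (x - y)"
    and absv_mult: "absv (x * y) = absv x * absv y"
    and absv_add_le: "absv (x + y) \<le> max (absv x) (absv y)"

definition is_subfield :: "'k::field set \<Rightarrow> bool" where
  "is_subfield A \<longleftrightarrow> 0 \<in> A \<and> 1 \<in> A \<and>
     (\<forall>x\<in>A. \<forall>y\<in>A. x + y \<in> A \<and> x * y \<in> A) \<and> (\<forall>x\<in>A. - x \<in> A \<and> inverse x \<in> A)"

definition algebraic_over :: "'k::field set \<Rightarrow> 'k \<Rightarrow> bool" where
  "algebraic_over F x \<longleftrightarrow> (\<exists>f. f \<noteq> 0 \<and> (\<forall>i. coeff f i \<in> F) \<and> poly f x = 0)"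

definition is_algebraic_closure :: "'k::field set \<Rightarrow> 'k set \<Rightarrow> bool" where
  "is_algebraic_closure F A \<longleftrightarrow> is_subfield A \<and> F \<subseteq> A \<and> (\<forall>x\<in>A. algebraic_over F x) \<and>
     (\<forall>f. degree f > 0 \<and> (\<forall>i. coeff f i \<in> A) \<longrightarrow> (\<exists>x\<in>A. poly f x = 0))"

text \<open>
  The type \<open>'k\<close> is (a copy of) the field \<open>C\<^sub>p\<close>: it is complete and contains a dense algebraic
  closure of \<open>Q\<^sub>p\<close>. Since \<open>'k\<close> is complete and its absolute value restricts to the
  \<open>p\<close>-adic one on the rationals once \<open>absv p = 1 / p\<close>, the closure of the rationals in \<open>'k\<close> is
  their \<open>p\<close>-adic completion \<open>Q\<^sub>p\<close>.
\<close>

definition is_Cp :: "nat \<Rightarrow> 'k::complete_nonarch_field itself \<Rightarrow> bool" where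
  "is_Cp p _ \<longleftrightarrow> prime p \<and> absv (of_nat p :: 'k) = 1 / real p \<and>
     (\<exists>A :: 'k set. is_algebraic_closure (closure \<rat>) A \<and> closure A = UNIV)"

definition padic_exp :: "'k::complete_nonarch_field \<Rightarrow> 'k" where
  "padic_exp z = (\<Sum>n. z ^ n / of_nat (fact n))"

definition padic_log :: "'k::complete_nonarch_field \<Rightarrow> 'k" where
  "padic_log u = (\<Sum>n. (- 1) ^ n * (u - 1) ^ Suc n / of_nat (Suc n))"

definition qpow :: "'k::complete_nonarch_field \<Rightarrow> 'k \<Rightarrow> 'k" where
  "qpow q x = padic_exp (x * padic_log q)"

definition qbracket :: "'k::complete_nonarch_field \<Rightarrow> 'k \<Rightarrow> 'k" where
  "qbracket q x = (1 - qpow q x) / (1 - q)"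

text \<open>
  Functions on \<open>Z\<^sub>p\<close> are represented by functions on \<open>'k\<close>; the integrals only depend on their
  values at the natural numbers.
\<close>

definition volkenborn_Zp ::
  "nat \<Rightarrow> 'k::complete_nonarch_field \<Rightarrow> ('k \<Rightarrow> 'k) \<Rightarrow> 'k" where
  "volkenborn_Zp p q g =
     lim (\<lambda>N. 1 / qbracket q (of_nat (p ^ N)) * (\<Sum>i<p ^ N. q ^ i * g (of_nat i)))"

definition volkenborn_Tp ::
  "nat \<Rightarrow> 'k::complete_nonarch_field \<Rightarrow> ('k \<Rightarrow> 'k) \<Rightarrow> 'k" where
  "volkenborn_Tp p q g =
     lim (\<lambda>N. 1 / qbracket q (of_nat (p ^ N)) *
                (\<Sum>i \<in> {i. i < p ^ N \<and> \<not> p dvd i}. q ^ i * g (of_nat i)))"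

definition qbernoulli :: "nat \<Rightarrow> 'k::complete_nonarch_field \<Rightarrow> nat \<Rightarrow> 'k" where
  "qbernoulli p q n = volkenborn_Zp p q (\<lambda>x. qpow q (- x) * qbracket q x ^ n)"

text \<open>
  \<open>pow_mult b m s\<close> is \<open>b\<close> to the power \<open>m s\<close>: the ordinary power if \<open>s\<close> is a natural number, and
  otherwise \<open>exp (s log (b ^ m))\<close>, which makes sense where the two series converge.
\<close>

definition pow_mult :: "'k::complete_nonarch_field \<Rightarrow> nat \<Rightarrow> 'k \<Rightarrow> 'k" where
  "pow_mult b m s =
     (if s \<in> \<nat> then b ^ (m * (THE n. s = of_nat n)) else padic_exp (s * padic_log (b ^ m)))"

definition padic_qzeta0 :: "nat \<Rightarrow> 'k::complete_nonarch_field \<Rightarrow> 'k \<Rightarrow> 'k" where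
  "padic_qzeta0 p q s = 1 / (of_nat (p - 1) * s) *
     volkenborn_Tp p q (\<lambda>x. qpow q (- x) * pow_mult (qbracket q x) (p - 1) s)"

end

theory Submission
  imports Defs
begin

text \<open>
  Put \<open>m = (p - 1) n\<close>. On natural numbers \<open>q\<^sup>x\<close> is the ordinary power, so the weights \<open>q\<^sup>i\<close> and
  \<open>q\<^sup>-\<^sup>i\<close> cancel and every integral in the theorem is the limit of a mean of the numbers
  \<open>[i]\<^sup>m\<close> over \<open>i < p\<^sup>N\<close> (\<open>bracket_moment\<close>). In such a mean the multiples of \<open>p\<close> contribute, by
  \<open>[pj : q] = [p : q] [j : q\<^sup>p]\<close>, exactly \<open>[p]\<close> to the power \<open>m - 1\<close> times the mean of level
  \<open>N - 1\<close> for \<open>q\<^sup>p\<close> (\<open>bracket_moment_without_multiples\<close>). The identity is then the limit of this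
  equation, once two analytic facts are known.

  The first is \<open>exp (log u) = u\<close> on the disc \<open>\<bar>u - 1\<bar> < p powr (-1 / (p - 1))\<close>
  (\<open>padic_exp_log\<close>). Composing the two series is avoided. Writing \<open>P = p\<^sup>N\<close>, binomial expansion
  gives \<open>u\<^sup>P = 1 + P log u + O(P\<^sup>2)\<close> (\<open>absv_power_minus_1_minus_log_le\<close>), and the
  exponential series gives \<open>exp (P z) = 1 + P z + O(P\<^sup>2)\<close>. With
  \<open>L = log u\<close> and \<open>v = exp L / u\<close>, additivity of \<open>exp\<close> turns these into
  \<open>v\<^sup>P = 1 + O(P\<^sup>2)\<close>. Hence \<open>log v = O(P)\<close> for every \<open>N\<close>, so \<open>log v = 0\<close>; and
  the logarithm vanishes only at \<open>1\<close> because its linear term dominates.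

  The second is convergence of the means (\<open>convergent_bracket_moment\<close>). Expanding \<open>[i]\<^sup>m\<close>
  in powers of \<open>q\<^sup>i\<close> leaves geometric sums divided by \<open>1 - q\<^sup>P\<close>, all of which converge because
  \<open>q\<^sup>P\<close> tends to \<open>1\<close> and \<open>(q\<^sup>P - 1) / P\<close> tends to \<open>log q\<close>, which is not zero.
\<close>

section \<open>Ultrametric calculus\<close>

lemma absv_eq_dist: "absv (x :: 'a::complete_nonarch_field) = dist x 0"
  by (simp add: dist_absv)

lemma absv_nonneg [simp]: "0 \<le> absv (x :: 'a::complete_nonarch_field)"
  by (simp add: absv_eq_dist)

lemma absv_0 [simp]: "absv (0 :: 'a::complete_nonarch_field) = 0"
  by (simp add: absv_eq_dist)

lemma absv_eq_0_iff [simp]: "absv (x :: 'a::complete_nonarch_field) = 0 \<longleftrightarrow> x = 0"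
  by (simp add: absv_eq_dist)

lemma absv_1 [simp]: "absv (1 :: 'a::complete_nonarch_field) = 1"
  using absv_mult[of "1 :: 'a" 1] by simp

lemma absv_minus [simp]: "absv (- x :: 'a::complete_nonarch_field) = absv x"
proof -
  have "absv (- 1 :: 'a) ^ 2 = 1"
    using absv_mult[of "- 1 :: 'a" "- 1"] by (simp add: power2_eq_square)
  then have "absv (- 1 :: 'a) = 1"
    by (simp add: power2_eq_1_iff) (use absv_nonneg[of "- 1 :: 'a"] in linarith)
  then show ?thesis
    using absv_mult[of "- 1" x] by simp
qed

lemma absv_diff_le: "absv (x - y :: 'a::complete_nonarch_field) \<le> max (absv x) (absv y)"
  using absv_add_le[of x "- y"] by simp

lemma absv_power: "absv (x ^ n :: 'a::complete_nonarch_field) = absv x ^ n"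
  by (induction n) (simp_all add: absv_mult)

lemma absv_divide: "absv (x / y :: 'a::complete_nonarch_field) = absv x / absv y"
proof (cases "y = 0")
  case False
  then show ?thesis
    using absv_mult[of "x / y" y] by (simp add: field_simps)
qed simp

lemma absv_add_boundI:
  "absv x \<le> B \<Longrightarrow> absv y \<le> B \<Longrightarrow> absv (x + y :: 'a::complete_nonarch_field) \<le> B"
  using absv_add_le[of x y] by linarith

lemma absv_diff_boundI:
  "absv x \<le> B \<Longrightarrow> absv y \<le> B \<Longrightarrow> absv (x - y :: 'a::complete_nonarch_field) \<le> B"
  using absv_diff_le[of x y] by linarith

lemma absv_sum_boundI:
  fixes f :: "'b \<Rightarrow> 'a::complete_nonarch_field"
  assumes "0 \<le> B" and "\<And>i. i \<in> A \<Longrightarrow> absv (f i) \<le> B"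
  shows "absv (sum f A) \<le> B"
  using assms by (induction A rule: infinite_finite_induct) (auto intro: absv_add_boundI)

lemma absv_of_nat_le_1 [simp]: "absv (of_nat n :: 'a::complete_nonarch_field) \<le> 1"
  by (induction n) (auto intro: absv_add_boundI)

lemma absv_eq_1_if_near_1:
  assumes "absv (u - 1 :: 'a::complete_nonarch_field) < 1"
  shows "absv u = 1"
  using absv_add_le[of "u - 1" 1] absv_diff_le[of u "u - 1"] assms by simp

lemma absv_power_minus_1_le:
  assumes "absv (u :: 'a::complete_nonarch_field) \<le> 1"
  shows "absv (u ^ n - 1) \<le> absv (u - 1)"
proof -
  have "absv (\<Sum>i<n. u ^ i) \<le> 1"
    by (rule absv_sum_boundI) (simp_all add: absv_power power_le_one assms)
  then show ?thesis
    by (simp add: power_diff_1_eq absv_mult mult_left_le)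
qed

lemma tendsto_absv_iff:
  "((f :: _ \<Rightarrow> 'a::complete_nonarch_field) \<longlongrightarrow> l) F \<longleftrightarrow> ((\<lambda>x. absv (f x - l)) \<longlongrightarrow> 0) F"
  unfolding tendsto_dist_iff[of f l] dist_absv by (rule refl)

lemma absv_fst_tendsto_0:
  "((\<lambda>x :: 'a \<times> 'b. absv (fst x - a)) \<longlongrightarrow> 0) (nhds (a :: 'a::complete_nonarch_field) \<times>\<^sub>F B)"
  by (simp only: tendsto_absv_iff[symmetric] filterlim_fst)

lemma absv_snd_tendsto_0:
  "((\<lambda>x :: 'b \<times> 'a. absv (snd x - a)) \<longlongrightarrow> 0) (B \<times>\<^sub>F nhds (a :: 'a::complete_nonarch_field))"
  by (simp only: tendsto_absv_iff[symmetric] filterlim_snd)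

lemma tendsto_nonarchI:
  fixes f :: "'b \<Rightarrow> 'a::complete_nonarch_field"
  assumes "(g \<longlongrightarrow> 0) F" and "\<And>x. absv (f x - l) \<le> g x"
  shows "(f \<longlongrightarrow> l) F"
proof -
  have "((\<lambda>x. absv (f x - l)) \<longlongrightarrow> 0) F"
    by (rule tendsto_sandwich[OF _ _ tendsto_const assms(1)])
      (intro always_eventually allI absv_nonneg assms(2))+
  then show ?thesis
    by (simp only: tendsto_absv_iff)
qed

lemma nonarch_add_continuous:
  fixes a b :: "'a::complete_nonarch_field"
  shows "((\<lambda>x. fst x + snd x) \<longlongrightarrow> a + b) (nhds a \<times>\<^sub>F nhds b)"
proof (rule tendsto_nonarchI)
  show "((\<lambda>x. absv (fst x - a) + absv (snd x - b)) \<longlongrightarrow> 0) (nhds a \<times>\<^sub>F nhds b)"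
    using tendsto_add[OF absv_fst_tendsto_0 absv_snd_tendsto_0] by simp
  show "absv (fst x + snd x - (a + b)) \<le> absv (fst x - a) + absv (snd x - b)" for x
    unfolding add_diff_add by (rule absv_add_boundI) simp_all
qed

lemma nonarch_mult_continuous:
  fixes a b :: "'a::complete_nonarch_field"
  shows "((\<lambda>x. fst x * snd x) \<longlongrightarrow> a * b) (nhds a \<times>\<^sub>F nhds b)"
proof (rule tendsto_nonarchI)
  let ?g = "\<lambda>x. absv (fst x - a) * absv (snd x - b) + absv a * absv (snd x - b)
      + absv (fst x - a) * absv b"
  have "(?g \<longlongrightarrow> 0 * 0 + absv a * 0 + 0 * absv b) (nhds a \<times>\<^sub>F nhds b)"
    by (intro tendsto_add tendsto_mult tendsto_const absv_fst_tendsto_0 absv_snd_tendsto_0)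
  then show "(?g \<longlongrightarrow> 0) (nhds a \<times>\<^sub>F nhds b)"
    by simp
  show "absv (fst x * snd x - a * b) \<le> ?g x" for x
  proof -
    have "fst x * snd x - a * b
        = ((fst x - a) * (snd x - b) + a * (snd x - b)) + (fst x - a) * b"
      by (simp add: algebra_simps)
    also have "absv \<dots> \<le> ?g x"
      by (intro absv_add_boundI) (simp_all add: absv_mult)
    finally show ?thesis .
  qed
qed

lemma nonarch_minus_continuous: "(uminus \<longlongrightarrow> - a) (nhds (a :: 'a::complete_nonarch_field))"
proof (rule tendsto_nonarchI)
  have "((\<lambda>x. x) \<longlongrightarrow> a) (nhds a)"
    by (rule filterlim_ident)
  then show "((\<lambda>x. absv (x - a)) \<longlongrightarrow> 0) (nhds a)"
    by (simp only: tendsto_absv_iff)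
  show "absv (- x - - a) \<le> absv (x - a)" for x
    using absv_minus[of "x - a"] by simp
qed

text \<open>These instances bring the limit laws for sums, products and powers.\<close>

instance complete_nonarch_field \<subseteq> topological_ab_group_add
  by intro_classes (rule nonarch_add_continuous nonarch_minus_continuous)+

instance complete_nonarch_field \<subseteq> topological_monoid_mult
  by intro_classes (rule nonarch_mult_continuous)

lemma tendsto_inverse_nonarch:
  fixes f :: "_ \<Rightarrow> 'a::complete_nonarch_field"
  assumes lim: "(f \<longlongrightarrow> l) F" and "l \<noteq> 0"
  shows "((\<lambda>x. inverse (f x)) \<longlongrightarrow> inverse l) F"
proof -
  have "0 < absv l"
    using \<open>l \<noteq> 0\<close> absv_nonneg[of l] absv_eq_0_iff[of l] by linarith
  then have "eventually (\<lambda>x. absv (f x - l) < absv l) F"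
    using lim by (simp add: tendsto_iff dist_absv)
  \<comment> \<open>Near \<open>l\<close> the absolute value is constant, so the usual quotient bound is an equation.\<close>
  then have ev: "eventually (\<lambda>x. absv (f x - l) / (absv l * absv l)
      = absv (inverse (f x) - inverse l)) F"
  proof eventually_elim
    case (elim x)
    then have eq: "absv (f x) = absv l"
      using absv_add_le[of "f x - l" l] absv_diff_le[of "f x" "f x - l"] by simp
    then have "f x \<noteq> 0"
      using \<open>0 < absv l\<close> by auto
    then have "inverse (f x) - inverse l = - ((f x - l) / (f x * l))"
      using \<open>l \<noteq> 0\<close> by (simp add: field_simps)
    then show ?case
      by (simp add: eq absv_divide absv_mult)
  qed
  have "((\<lambda>x. absv (f x - l)) \<longlongrightarrow> 0) F"
    using lim by (simp only: tendsto_absv_iff)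
  then have "((\<lambda>x. absv (f x - l) / (absv l * absv l)) \<longlongrightarrow> 0) F"
    by (rule tendsto_divide_zero)
  from Lim_transform_eventually[OF this ev] show ?thesis
    by (simp only: tendsto_absv_iff)
qed

lemma absv_lim_boundI:
  fixes f :: "nat \<Rightarrow> 'a::complete_nonarch_field"
  assumes "f \<longlonglongrightarrow> l" and "\<And>n. absv (f n) \<le> B"
  shows "absv l \<le> B"
proof (rule LIMSEQ_le_const2)
  show "(\<lambda>n. absv (f n)) \<longlonglongrightarrow> absv l"
    unfolding absv_eq_dist by (intro tendsto_dist assms tendsto_const)
qed (use assms in auto)

lemma absv_sums_boundI:
  fixes f :: "nat \<Rightarrow> 'a::complete_nonarch_field"
  assumes "f sums s" and "\<And>n. absv (f n) \<le> B"
  shows "absv s \<le> B"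
proof (rule absv_lim_boundI)
  show "(\<lambda>n. \<Sum>i<n. f i) \<longlonglongrightarrow> s"
    using assms(1) by (simp add: sums_def)
  show "absv (\<Sum>i<n. f i) \<le> B" for n
    using assms(2) by (intro absv_sum_boundI order.trans[OF absv_nonneg assms(2)])
qed

lemma summable_nonarch:
  fixes f :: "nat \<Rightarrow> 'a::complete_nonarch_field"
  assumes "(\<lambda>n. absv (f n)) \<longlonglongrightarrow> 0"
  shows "summable f"
  unfolding summable_iff_convergent Cauchy_convergent_iff[symmetric]
proof (rule metric_CauchyI)
  fix e :: real assume "e > 0"
  then have "eventually (\<lambda>n. absv (f n) < e / 2) sequentially"
    using order_tendstoD(2)[OF assms, of "e / 2"] by simp
  then obtain M where M: "\<And>n. n \<ge> M \<Longrightarrow> absv (f n) < e / 2"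
    by (auto simp: eventually_sequentially)
  have "dist (\<Sum>i<m. f i) (\<Sum>i<n. f i) < e" if "M \<le> m" "m \<le> n" for m n
  proof -
    have "(\<Sum>i<n. f i) - (\<Sum>i<m. f i) = (\<Sum>i\<in>{m..<n}. f i)"
      using that sum_diff_nat_ivl[of 0 m n f] by (simp add: lessThan_atLeast0)
    moreover have "absv (\<Sum>i\<in>{m..<n}. f i) \<le> e / 2"
      using \<open>e > 0\<close> M that by (intro absv_sum_boundI) (auto intro!: less_imp_le)
    ultimately have "dist (\<Sum>i<n. f i) (\<Sum>i<m. f i) \<le> e / 2"
      by (simp add: dist_absv)
    then show ?thesis
      using \<open>e > 0\<close> by (simp add: dist_commute)
  qed
  then show "\<exists>M. \<forall>m\<ge>M. \<forall>n\<ge>M. dist (\<Sum>i<m. f i) (\<Sum>i<n. f i) < e"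
    by (metis dist_commute linear)
qed

lemma sums_mult_nonarch:
  fixes f :: "nat \<Rightarrow> 'a::complete_nonarch_field"
  assumes "f sums s"
  shows "(\<lambda>n. c * f n) sums (c * s)"
  using tendsto_mult_left[OF assms[unfolded sums_def], of c]
  by (simp add: sums_def sum_distrib_left)

lemma sums_diff_nonarch:
  fixes f g :: "nat \<Rightarrow> 'a::complete_nonarch_field"
  assumes "f sums s" and "g sums t"
  shows "(\<lambda>n. f n - g n) sums (s - t)"
  using sums_add[OF assms(1) sums_mult_nonarch[OF assms(2), of "- 1"]] by simp

section \<open>The disc of convergence of the exponential\<close>

text \<open>
  The absolute value of \<open>p\<close> determines that of every integer, hence the size of the denominators
  \<open>n!\<close> on which all estimates below rest.
\<close>

locale padic_nonarch_field =
  fixes p :: nat and K :: "'k::complete_nonarch_field itself"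
  assumes prime_p: "prime p" and absv_p: "absv (of_nat p :: 'k) = 1 / real p"
begin

definition rad :: real where
  "rad = real p powr (- 1 / (real p - 1))"

lemma p_gt_1: "1 < real p"
  using prime_gt_1_nat[OF prime_p] by simp

lemma rad_pos: "0 < rad" and rad_less_1: "rad < 1"
  using p_gt_1 by (simp_all add: rad_def powr_less_one divide_neg_pos)

lemma rad_power: "rad ^ (p - 1) = 1 / real p"
proof -
  have "rad ^ (p - 1) = real p powr ((- 1 / (real p - 1)) * real (p - 1))"
    using p_gt_1 by (simp add: rad_def powr_realpow[symmetric] powr_powr)
  also have "(- 1 / (real p - 1)) * real (p - 1) = - 1"
    using p_gt_1 by (simp add: field_simps of_nat_diff)
  finally show ?thesis
    using p_gt_1 by (simp add: powr_minus field_simps)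
qed

text \<open>
  A Bezout relation \<open>a m + b p = 1\<close> forces one of the two summands to have absolute value at least
  \<open>1\<close>, and the second one does not.
\<close>

lemma absv_of_nat_coprime:
  assumes "\<not> p dvd m"
  shows "absv (of_nat m :: 'k) = 1"
proof -
  have "coprime p m"
    using prime_p assms by (rule prime_imp_coprime)
  then obtain a b where ab: "a * int m + b * int p = 1"
    by (metis bezout_int coprime_iff_gcd_eq_1 gcd.commute gcd_int_int_eq of_nat_1)
  have abs_int: "absv (of_int c :: 'k) \<le> 1" for c
    by (cases c) (auto simp: absv_diff_boundI simp flip: of_nat_Suc)
  have "1 = absv (of_int (a * int m + b * int p) :: 'k)"
    by (simp add: ab)
  also have "\<dots> \<le> max (absv (of_int a * of_nat m :: 'k)) (absv (of_int b * of_nat p :: 'k))"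
    by (simp add: absv_add_le)
  finally have "1 \<le> absv (of_int a * of_nat m :: 'k) \<or> 1 \<le> absv (of_int b * of_nat p :: 'k)"
    by linarith
  moreover have "absv (of_int b * of_nat p :: 'k) \<le> 1 * (1 / real p)"
    unfolding absv_mult absv_p by (intro mult_right_mono abs_int) simp
  moreover have "1 / real p < 1"
    using p_gt_1 by simp
  moreover have "absv (of_int a * of_nat m :: 'k) \<le> 1 * absv (of_nat m :: 'k)"
    unfolding absv_mult by (intro mult_right_mono abs_int) simp
  ultimately have "1 \<le> absv (of_nat m :: 'k)"
    by linarith
  then show ?thesis
    using absv_of_nat_le_1[of m, where 'a = 'k] by linarith
qed

lemma absv_fact_add_small: "r < p \<Longrightarrow> absv (fact (p * k + r) :: 'k) = absv (fact (p * k) :: 'k)"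
proof (induction r)
  case (Suc r)
  have "\<not> p dvd (p * k + Suc r)"
    using Suc.prems by (metis dvd_add_right_iff dvd_triv_left nat_dvd_not_less zero_less_Suc)
  then have "absv (of_nat (p * k + Suc r) :: 'k) = 1"
    by (rule absv_of_nat_coprime)
  then show ?case
    using Suc by (simp add: absv_mult del: of_nat_add of_nat_Suc)
qed simp

lemma absv_fact_mult: "absv (fact (p * k) :: 'k) = (1 / real p) ^ k * absv (fact k :: 'k)"
proof (induction k)
  case (Suc k)
  obtain r where r: "p = Suc r"
    using p_gt_1 by (cases p) auto
  have Suc_k: "p * Suc k = Suc (p * k + r)"
    by (simp add: r)
  then have "absv (fact (p * Suc k) :: 'k) = absv (fact (Suc (p * k + r)) :: 'k)"
    by (simp only:)
  also have "\<dots> = absv (of_nat (Suc (p * k + r)) :: 'k) * absv (fact (p * k + r) :: 'k)"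
    by (simp add: absv_mult del: of_nat_add of_nat_Suc)
  also note Suc_k[symmetric]
  also have "absv (fact (p * k + r) :: 'k) = absv (fact (p * k) :: 'k)"
    by (rule absv_fact_add_small) (simp add: r)
  also have "absv (of_nat (p * Suc k) :: 'k) = 1 / real p * absv (of_nat (Suc k) :: 'k)"
    by (simp only: of_nat_mult absv_mult absv_p)
  finally show ?case
    by (simp add: Suc absv_mult del: of_nat_Suc)
qed simp

text \<open>
  The sharp exponent \<open>n - 1\<close> is what makes all terms of \<open>exp z\<close> after the constant one bounded by \<open>\<bar>z\<bar>\<close>
  on the disc. For \<open>n = p k + r\<close> with \<open>r < p\<close>, the factors of \<open>n!\<close> prime to \<open>p\<close> are units and
  the others combine to \<open>p\<^sup>k k!\<close>, so the bound for \<open>k\<close> gives the bound for \<open>n\<close>, in view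
  of \<open>rad_power\<close>.
\<close>

lemma rad_power_le_absv_fact: "rad ^ (n - 1) \<le> absv (fact n :: 'k)"
proof (induction n rule: less_induct)
  case (less n)
  define k r where "k = n div p" and "r = n mod p"
  have n: "n = p * k + r" and "r < p"
    using p_gt_1 by (simp_all add: k_def r_def)
  then have fact_n: "absv (fact n :: 'k) = (1 / real p) ^ k * absv (fact k :: 'k)"
    by (simp add: absv_fact_add_small absv_fact_mult)
  show ?case
  proof (cases "k = 0")
    case True
    then show ?thesis
      using fact_n rad_pos rad_less_1 by (simp add: power_le_one)
  next
    case False
    have "k < n"
      using False n p_gt_1 by (cases p) auto
    have "rad ^ (n - 1) \<le> rad ^ ((p - 1) * k + (k - 1))"
    proof (rule power_decreasing)
      show "(p - 1) * k + (k - 1) \<le> n - 1"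
        using False n p_gt_1 by (cases p) auto
    qed (use rad_pos rad_less_1 in auto)
    also have "\<dots> = (1 / real p) ^ k * rad ^ (k - 1)"
      by (simp only: power_add power_mult rad_power)
    also have "\<dots> \<le> absv (fact n :: 'k)"
      unfolding fact_n by (intro mult_left_mono less.IH \<open>k < n\<close>) simp
    finally show ?thesis .
  qed
qed

lemma absv_exp_term_le:
  fixes z :: 'k
  shows "absv (z ^ Suc n / fact (Suc n)) \<le> absv z * (absv z / rad) ^ n"
proof -
  have "absv (z ^ Suc n / fact (Suc n)) = absv z ^ Suc n / absv (fact (Suc n) :: 'k)"
    by (simp only: absv_divide absv_power)
  also have "\<dots> \<le> absv z ^ Suc n / rad ^ n"
  proof -
    have pos: "0 < rad ^ n" and le: "rad ^ n \<le> absv (fact (Suc n) :: 'k)"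
      using rad_pos rad_power_le_absv_fact[of "Suc n"] by simp_all
    show ?thesis
      by (intro divide_left_mono mult_pos_pos less_le_trans[OF pos le] pos le) simp
  qed
  finally show ?thesis
    by (simp add: power_divide)
qed

lemma ratio_bounds: "absv (z :: 'k) < rad \<Longrightarrow> 0 \<le> absv z / rad \<and> absv z / rad < 1"
  using rad_pos by simp

lemma in_disc_mult: "absv (x :: 'k) \<le> 1 \<Longrightarrow> absv (z :: 'k) < rad \<Longrightarrow> absv (x * z) < rad"
  using mult_right_mono[of "absv x" 1 "absv z"] by (simp add: absv_mult)

lemma exp_term_tendsto_0:
  fixes z :: 'k
  assumes "absv z < rad"
  shows "(\<lambda>n. absv (z ^ n / fact n)) \<longlonglongrightarrow> 0"
proof -
  have "norm (absv z / rad) < 1"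
    unfolding real_norm_def using ratio_bounds[OF assms] by linarith
  then have "(\<lambda>n. absv z * (absv z / rad) ^ n) \<longlonglongrightarrow> absv z * 0"
    by (intro tendsto_mult tendsto_const LIMSEQ_power_zero)
  then have lim: "(\<lambda>n. absv z * (absv z / rad) ^ n) \<longlonglongrightarrow> 0"
    by simp
  have "(\<lambda>n. absv (z ^ Suc n / fact (Suc n))) \<longlonglongrightarrow> 0"
    by (rule tendsto_sandwich[OF _ _ tendsto_const lim])
      (intro always_eventually allI absv_nonneg absv_exp_term_le)+
  then show ?thesis
    by (rule LIMSEQ_imp_Suc)
qed

lemma padic_exp_sums:
  fixes z :: 'k
  assumes "absv z < rad"
  shows "(\<lambda>n. z ^ n / fact n) sums padic_exp z"
  using summable_sums[OF summable_nonarch[OF exp_term_tendsto_0[OF assms]]]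
  by (simp add: padic_exp_def)

lemma padic_exp_0: "padic_exp (0 :: 'k) = 1"
proof -
  have "(\<lambda>n. (0 :: 'k) ^ n / fact n) sums (\<Sum>n<1. 0 ^ n / fact n)"
    by (rule sums_finite) auto
  then show ?thesis
    using padic_exp_sums[of 0] rad_pos sums_unique2 by fastforce
qed

text \<open>
  For \<open>x\<close> a high power of \<open>p\<close> this is first-order Taylor expansion at \<open>0\<close> in the direction \<open>z\<close>:
  a term of order \<open>k \<ge> 2\<close> is \<open>x\<^sup>k\<close> times a term of \<open>exp z\<close>.
\<close>

lemma absv_padic_exp_minus_1_minus_le:
  fixes x z :: 'k
  assumes "absv x \<le> 1" and "absv z < rad"
  shows "absv (padic_exp (x * z) - 1 - x * z) \<le> absv x ^ 2 * absv z"
proof (rule absv_sums_boundI)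
  have "(\<lambda>n. if n < 2 then (x * z) ^ n / fact n else 0) sums (\<Sum>n<2. (x * z) ^ n / fact n)"
    using sums_If_finite_set[of "{..<2}" "\<lambda>n. (x * z) ^ n / fact n"] by simp
  from sums_diff_nonarch[OF padic_exp_sums[OF in_disc_mult[OF assms]] this]
  show "(\<lambda>n. (x * z) ^ n / fact n - (if n < 2 then (x * z) ^ n / fact n else 0))
      sums (padic_exp (x * z) - 1 - x * z)"
    by (simp add: eval_nat_numeral algebra_simps)
  show "absv ((x * z) ^ n / fact n - (if n < 2 then (x * z) ^ n / fact n else 0))
      \<le> absv x ^ 2 * absv z" for n
  proof (cases "n < 2")
    case False
    then obtain m where n: "n = Suc m" and "2 \<le> n"
      by (cases n) auto
    have "absv ((x * z) ^ n / fact n) = absv x ^ n * absv (z ^ n / fact n)"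
      by (simp add: absv_mult absv_power absv_divide power_mult_distrib)
    also have "\<dots> \<le> absv x ^ 2 * absv z"
    proof (rule mult_mono)
      show "absv x ^ n \<le> absv x ^ 2"
        using \<open>2 \<le> n\<close> assms(1) by (intro power_decreasing) auto
      have "absv (z ^ n / fact n) \<le> absv z * (absv z / rad) ^ m"
        unfolding n by (rule absv_exp_term_le)
      also have "\<dots> \<le> absv z"
        using ratio_bounds[OF assms(2)] by (simp add: mult_left_le power_le_one)
      finally show "absv (z ^ n / fact n) \<le> absv z" .
    qed auto
    finally show ?thesis
      using False by simp
  qed simp
qed

text \<open>
  The product of the \<open>n\<close>-th partial sums at \<open>a\<close> and \<open>b\<close> is a sum over a square, and by the
  binomial theorem the partial sum at \<open>a + b\<close> is the part of it below the diagonal \<open>i + j = n\<close>. Each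
  remaining product is at most \<open>\<rho>\<^sup>n\<close> in absolute value, where \<open>\<rho> < 1\<close> is the larger of
  \<open>\<bar>a\<bar> / rad\<close> and \<open>\<bar>b\<bar> / rad\<close>, and by the ultrametric inequality so is their sum.
\<close>

lemma padic_exp_add:
  fixes a b :: 'k
  assumes a: "absv a < rad" and b: "absv b < rad"
  shows "padic_exp (a + b) = padic_exp a * padic_exp b"
proof -
  define \<rho> where "\<rho> = max (absv a) (absv b) / rad"
  have \<rho>: "0 \<le> \<rho>" "\<rho> < 1"
    using a b rad_pos by (auto simp: \<rho>_def le_max_iff_disj intro!: divide_nonneg_pos)
  have term_le: "absv (c ^ n / fact n) \<le> \<rho> ^ n" if "c = a \<or> c = b" for c :: 'k and n
  proof (cases n)
    case (Suc m)
    have c: "absv c / rad \<le> \<rho>"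
      using that rad_pos by (auto simp: \<rho>_def intro!: divide_right_mono)
    have "absv c \<le> absv c / rad"
      using rad_pos rad_less_1 by (simp add: field_simps mult_left_le)
    then have "absv c * (absv c / rad) ^ m \<le> \<rho> * \<rho> ^ m"
      using c rad_pos \<rho> by (intro mult_mono power_mono) auto
    then show ?thesis
      using absv_exp_term_le[of c m] by (simp only: Suc power_Suc)
  qed simp
  define E where "E z n = (\<Sum>i<n. z ^ i / fact i :: 'k)" for z n
  have expand: "E (a + b) n = (\<Sum>(i, j)\<in>{(i, j). i + j < n}. (a ^ i / fact i) * (b ^ j / fact j))" for n
  proof -
    have "(a + b) ^ k / fact k = (\<Sum>i\<le>k. (a ^ i / fact i) * (b ^ (k - i) / fact (k - i)))" for k
      unfolding binomial_ring sum_divide_distrib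
      by (rule sum.cong) (simp_all add: binomial_fact field_simps)
    then have "E (a + b) n = (\<Sum>k<n. \<Sum>i\<le>k. (a ^ i / fact i) * (b ^ (k - i) / fact (k - i)))"
      by (simp add: E_def)
    also have "\<dots> = (\<Sum>(i, j)\<in>{(i, j). i + j < n}. (a ^ i / fact i) * (b ^ j / fact j))"
      by (rule sum.triangle_reindex[symmetric])
    finally show ?thesis .
  qed
  have "absv (E a n * E b n - E (a + b) n - 0) \<le> \<rho> ^ n" for n
  proof -
    let ?f = "\<lambda>(i, j). (a ^ i / fact i) * (b ^ j / fact j)"
    have "E a n * E b n = sum ?f ({..<n} \<times> {..<n})"
      by (simp add: E_def sum_product sum.cartesian_product)
    then have "E a n * E b n - E (a + b) n = sum ?f ({..<n} \<times> {..<n} - {(i, j). i + j < n})"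
      unfolding expand by (subst sum_diff) auto
    also have "absv \<dots> \<le> \<rho> ^ n"
    proof (rule absv_sum_boundI)
      fix x assume "x \<in> {..<n} \<times> {..<n} - {(i, j). i + j < n}"
      then obtain i j where x: "x = (i, j)" and ij: "n \<le> i + j"
        by (cases x) auto
      have "absv (?f x) \<le> \<rho> ^ i * \<rho> ^ j"
        unfolding x prod.case absv_mult using \<rho> by (intro mult_mono term_le) auto
      also have "\<dots> \<le> \<rho> ^ n"
        using \<rho> ij by (simp flip: power_add add: power_decreasing)
      finally show "absv (?f x) \<le> \<rho> ^ n" .
    qed (use \<rho> in simp)
    finally show ?thesis
      by (simp only: diff_0_right)
  qed
  moreover have "(\<lambda>n. \<rho> ^ n) \<longlonglongrightarrow> 0"
    using \<rho> by (intro LIMSEQ_power_zero) (simp only: real_norm_def abs_of_nonneg)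
  ultimately have lim0: "(\<lambda>n. E a n * E b n - E (a + b) n) \<longlonglongrightarrow> 0"
    by (intro tendsto_nonarchI)
  have E: "E z \<longlonglongrightarrow> padic_exp z" if "absv z < rad" for z
    using padic_exp_sums[OF that] by (simp add: sums_def E_def[abs_def])
  have "absv (a + b) < rad"
    using a b absv_add_le[of a b] by linarith
  from tendsto_add[OF lim0 E[OF this]]
  have "(\<lambda>n. E a n * E b n) \<longlonglongrightarrow> padic_exp (a + b)"
    by simp
  moreover have "(\<lambda>n. E a n * E b n) \<longlonglongrightarrow> padic_exp a * padic_exp b"
    by (intro tendsto_mult E a b)
  ultimately show ?thesis
    by (rule LIMSEQ_unique)
qed

lemma padic_exp_of_nat_mult:
  fixes z :: 'k
  assumes "absv z < rad"
  shows "padic_exp (of_nat n * z) = padic_exp z ^ n"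
proof (induction n)
  case (Suc n)
  have "padic_exp (z + of_nat n * z) = padic_exp z * padic_exp (of_nat n * z)"
    using assms by (intro padic_exp_add in_disc_mult) auto
  then show ?case
    by (simp only: Suc of_nat_Suc distrib_right mult_1_left power_Suc)
qed (simp add: padic_exp_0)

section \<open>The logarithm as a derivative of powers\<close>

text \<open>
  If \<open>m + 1\<close> is divisible by a high power of \<open>p\<close>, then \<open>m\<close> is close to \<open>- 1\<close> and \<open>m choose k\<close>
  is close to \<open>(- 1) gchoose k = (- 1)\<^sup>k\<close>. The factor \<open>k!\<close> clears the denominators met in the
  induction along Pascal's rule.
\<close>

lemma absv_binomial_minus_sign_le:
  "absv (of_nat (m choose k) - (- 1) ^ k :: 'k) * absv (fact k :: 'k) \<le> absv (of_nat (Suc m) :: 'k)"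
proof (induction k)
  case (Suc k)
  let ?d = "\<lambda>k. of_nat (m choose k) - (- 1) ^ k :: 'k"
  have "?d (Suc k) = of_nat (Suc m choose Suc k) - ?d k"
    by simp
  then have "?d (Suc k) * fact (Suc k)
      = of_nat (Suc k * (Suc m choose Suc k)) * fact k - of_nat (Suc k) * (?d k * fact k)"
    by (simp add: algebra_simps)
  also have "of_nat (Suc k * (Suc m choose Suc k)) * fact k
      = (of_nat (Suc m) * of_nat ((m choose k) * fact k) :: 'k)"
    unfolding Suc_times_binomial by (simp only: of_nat_mult of_nat_fact mult.assoc)
  finally have eq: "?d (Suc k) * fact (Suc k)
      = of_nat (Suc m) * of_nat ((m choose k) * fact k) - of_nat (Suc k) * (?d k * fact k)" .
  have "absv (?d (Suc k) * fact (Suc k)) \<le> absv (of_nat (Suc m) :: 'k)"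
    unfolding eq
  proof (rule absv_diff_boundI)
    show "absv (of_nat (Suc m) * of_nat ((m choose k) * fact k) :: 'k) \<le> absv (of_nat (Suc m) :: 'k)"
      unfolding absv_mult by (rule mult_left_le) (simp_all del: of_nat_mult)
    have "absv (of_nat (Suc k) * (?d k * fact k)) \<le> absv (?d k * fact k)"
      unfolding absv_mult[of "of_nat (Suc k)"] by (rule mult_left_le_one_le) (simp_all del: of_nat_Suc)
    also have "\<dots> \<le> absv (of_nat (Suc m) :: 'k)"
      using Suc by (simp only: absv_mult)
    finally show "absv (of_nat (Suc k) * (?d k * fact k)) \<le> absv (of_nat (Suc m) :: 'k)" .
  qed
  then show ?case
    by (simp only: absv_mult)
qed simp

lemma padic_log_sums:
  fixes u :: 'k
  assumes "absv (u - 1) < rad"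
  shows "(\<lambda>n. (- 1) ^ n * (u - 1) ^ Suc n / of_nat (Suc n)) sums padic_log u"
proof -
  have le: "absv ((- 1) ^ n * (u - 1) ^ Suc n / of_nat (Suc n))
      \<le> absv ((u - 1) ^ Suc n / fact (Suc n))" for n
  proof -
    have "(- 1) ^ n * (u - 1) ^ Suc n / of_nat (Suc n)
        = of_nat (fact n) * (- 1) ^ n * ((u - 1) ^ Suc n / fact (Suc n))"
      by (simp add: divide_simps del: of_nat_Suc power_Suc)
    also have "absv \<dots> \<le> absv ((u - 1) ^ Suc n / fact (Suc n))"
      unfolding absv_mult[of "of_nat (fact n) * (- 1) ^ n"]
      by (rule mult_left_le_one_le) (simp_all add: absv_mult absv_power del: of_nat_fact)
    finally show ?thesis .
  qed
  have lim: "(\<lambda>n. absv ((u - 1) ^ Suc n / fact (Suc n))) \<longlonglongrightarrow> 0"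
    using exp_term_tendsto_0[OF assms] by (rule LIMSEQ_Suc)
  have "(\<lambda>n. absv ((- 1) ^ n * (u - 1) ^ Suc n / of_nat (Suc n))) \<longlonglongrightarrow> 0"
    by (rule tendsto_sandwich[OF _ _ tendsto_const lim]) (intro always_eventually allI absv_nonneg le)+
  then show ?thesis
    unfolding padic_log_def by (intro summable_sums summable_nonarch)
qed

text \<open>
  With \<open>t = u - 1\<close>, the coefficient of \<open>t\<close> to the power \<open>k + 1\<close> in \<open>u\<^sup>n - 1\<close> is
  \<open>n / (k + 1)\<close> times \<open>(n - 1) choose k\<close>, and in \<open>n log u\<close> it is the same with the binomial
  coefficient replaced by its sign \<open>(- 1)\<^sup>k\<close>. The linear terms agree, and by \<open>absv_binomial_minus_sign_le\<close>
  the others differ by at most \<open>\<bar>n\<bar>\<^sup>2\<close> times a term of \<open>exp t\<close>. The extra factor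
  \<open>\<bar>t\<bar> / rad < 1\<close> matters for \<open>n = 1\<close>, where the lemma says that \<open>log u\<close> is strictly
  closer to \<open>t\<close> than \<open>0\<close> is, unless \<open>t = 0\<close>.
\<close>

lemma absv_power_minus_1_minus_log_le:
  fixes u :: 'k
  assumes u: "absv (u - 1) < rad" and "0 < n"
  shows "absv (u ^ n - 1 - of_nat n * padic_log u)
      \<le> absv (of_nat n :: 'k) ^ 2 * (absv (u - 1) * (absv (u - 1) / rad))"
proof (rule absv_sums_boundI)
  define t where "t = u - 1"
  obtain m where n: "n = Suc m"
    using \<open>0 < n\<close> by (cases n) auto
  have "(\<lambda>k. of_nat (n choose Suc k) * t ^ Suc k) sums (\<Sum>k<n. of_nat (n choose Suc k) * t ^ Suc k)"
    by (rule sums_finite) (auto simp: binomial_eq_0)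
  also have "(\<Sum>k<n. of_nat (n choose Suc k) * t ^ Suc k) = (t + 1) ^ n - 1"
    unfolding binomial_ring by (simp add: sum.atMost_shift)
  finally have pow: "(\<lambda>k. of_nat (n choose Suc k) * t ^ Suc k) sums (u ^ n - 1)"
    by (simp add: t_def)
  from sums_diff_nonarch[OF pow sums_mult_nonarch[OF padic_log_sums[OF u], of "of_nat n"]]
  show "(\<lambda>k. of_nat (n choose Suc k) * t ^ Suc k
        - of_nat n * ((- 1) ^ k * (u - 1) ^ Suc k / of_nat (Suc k)))
      sums (u ^ n - 1 - of_nat n * padic_log u)" .
  show "absv (of_nat (n choose Suc k) * t ^ Suc k
        - of_nat n * ((- 1) ^ k * (u - 1) ^ Suc k / of_nat (Suc k)))
      \<le> absv (of_nat n :: 'k) ^ 2 * (absv (u - 1) * (absv (u - 1) / rad))" for k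
  proof -
    let ?d = "of_nat (m choose k) - (- 1) ^ k :: 'k"
    have "of_nat (Suc k) * (of_nat (n choose Suc k) :: 'k) = of_nat n * of_nat (m choose k)"
      unfolding n by (simp only: of_nat_mult[symmetric] Suc_times_binomial)
    then have binom: "of_nat (n choose Suc k) = of_nat n * of_nat (m choose k) / (of_nat (Suc k) :: 'k)"
      by (simp add: field_simps del: of_nat_Suc)
    have cancel: "a * c / s * x - a * (e * x / s) = a * ((c - e) * f) * (x / (s * f))"
      if "s \<noteq> 0" "f \<noteq> 0" for a c e f s x :: 'k
      using that by (simp add: field_simps)
    have eq: "of_nat (n choose Suc k) * t ^ Suc k
          - of_nat n * ((- 1) ^ k * (u - 1) ^ Suc k / of_nat (Suc k))
        = of_nat n * (?d * fact k) * (t ^ Suc k / fact (Suc k))"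
      unfolding binom fact_Suc t_def by (rule cancel[OF of_nat_neq_0 fact_nonzero])
    show ?thesis
    proof (cases k)
      case 0
      then show ?thesis
        unfolding eq using rad_pos by simp
    next
      case (Suc l)
      have "absv (t ^ Suc k / fact (Suc k)) \<le> absv t * (absv t / rad) ^ k"
        by (rule absv_exp_term_le)
      also have "\<dots> \<le> absv t * (absv t / rad)"
        unfolding Suc power_Suc t_def using ratio_bounds[OF u]
        by (intro mult_left_mono mult_left_le power_le_one) auto
      finally have "absv (of_nat n :: 'k) * (absv ?d * absv (fact k :: 'k)) * absv (t ^ Suc k / fact (Suc k))
          \<le> absv (of_nat n :: 'k) * absv (of_nat n :: 'k) * (absv t * (absv t / rad))"
        using absv_binomial_minus_sign_le[of m k] unfolding n by (intro mult_mono mult_left_mono) auto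
      then show ?thesis
        unfolding eq absv_mult by (simp add: power2_eq_square t_def)
    qed
  qed
qed

lemma absv_power_minus_1_minus_log_le_square:
  fixes u :: 'k
  assumes u: "absv (u - 1) < rad" and "0 < n"
  shows "absv (u ^ n - 1 - of_nat n * padic_log u) \<le> absv (of_nat n :: 'k) ^ 2"
proof -
  have "absv (u - 1) * (absv (u - 1) / rad) \<le> 1"
    using ratio_bounds[OF u] u rad_less_1 by (intro mult_le_one) auto
  then have "absv (of_nat n :: 'k) ^ 2 * (absv (u - 1) * (absv (u - 1) / rad)) \<le> absv (of_nat n :: 'k) ^ 2"
    by (intro mult_left_le zero_le_power2)
  then show ?thesis
    using absv_power_minus_1_minus_log_le[OF assms] by linarith
qed

lemma absv_padic_log_le:
  fixes u :: 'k
  assumes "absv (u - 1) < rad"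
  shows "absv (padic_log u) \<le> absv (u - 1)"
proof -
  have "absv (u - 1 - padic_log u) \<le> absv (u - 1) * (absv (u - 1) / rad)"
    using absv_power_minus_1_minus_log_le[OF assms, of 1] by simp
  also have "\<dots> \<le> absv (u - 1)"
    using ratio_bounds[OF assms] by (intro mult_left_le) auto
  finally show ?thesis
    using absv_diff_le[of "u - 1" "u - 1 - padic_log u"] by simp
qed

lemma padic_log_eq_0_imp:
  fixes u :: 'k
  assumes u: "absv (u - 1) < rad" and "padic_log u = 0"
  shows "u = 1"
proof (rule ccontr)
  assume "u \<noteq> 1"
  then have "0 < absv (u - 1)"
    by (metis absv_eq_0_iff absv_nonneg eq_iff_diff_eq_0 less_eq_real_def)
  then have "absv (u - 1) * (absv (u - 1) / rad) < absv (u - 1)"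
    using ratio_bounds[OF u] mult_strict_left_mono[of "absv (u - 1) / rad" 1 "absv (u - 1)"] by simp
  then show False
    using absv_power_minus_1_minus_log_le[OF u, of 1] assms(2) by simp
qed

lemma absv_p_power: "absv (of_nat (p ^ N) :: 'k) = (1 / real p) ^ N"
  by (simp add: absv_power absv_p)

lemma p_power_tendsto_0: "(\<lambda>N. (1 / real p) ^ N) \<longlonglongrightarrow> 0"
  using p_gt_1 by (intro LIMSEQ_power_zero) simp

lemma eq_0_if_absv_le_p_powers:
  fixes x :: 'k
  assumes "\<And>N. absv x \<le> (1 / real p) ^ N"
  shows "x = 0"
proof -
  have "absv x \<le> 0"
    using p_power_tendsto_0 by (rule LIMSEQ_le_const) (use assms in auto)
  then show ?thesis
    by (metis absv_eq_0_iff absv_nonneg antisym)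
qed

text \<open>
  The quotient \<open>v\<close> of the two sides satisfies \<open>\<bar>v\<^sup>P - 1\<bar> \<le> \<bar>P\<bar>\<^sup>2\<close> for every \<open>P = p\<^sup>N\<close>,
  since \<open>exp (P L)\<close> and \<open>u\<^sup>P\<close> have the same expansion to first order in \<open>P\<close>. Comparing with
  \<open>v\<^sup>P - 1 = P log v + O(P\<^sup>2)\<close> leaves no room for a nonzero \<open>log v\<close>.
\<close>

lemma padic_exp_log:
  fixes u :: 'k
  assumes u: "absv (u - 1) < rad"
  shows "padic_exp (padic_log u) = u"
proof -
  define L v where "L = padic_log u" and "v = padic_exp L / u"
  have L: "absv L < rad"
    using absv_padic_log_le[OF u] u by (simp add: L_def)
  have absv_u: "absv u = 1"
    using u rad_less_1 by (intro absv_eq_1_if_near_1) linarith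
  have expL: "absv (padic_exp L - 1) < rad"
  proof -
    have "absv (padic_exp L - 1 - L) \<le> absv L"
      using absv_padic_exp_minus_1_minus_le[of 1 L] L by simp
    then show ?thesis
      using absv_add_le[of "padic_exp L - 1 - L" L] L by simp
  qed
  have "u \<noteq> 0"
    using absv_u by auto
  have v: "absv (v - 1) < rad"
  proof -
    have "v - 1 = ((padic_exp L - 1) - (u - 1)) / u"
      using \<open>u \<noteq> 0\<close> by (simp add: v_def field_simps)
    then have "absv (v - 1) = absv ((padic_exp L - 1) - (u - 1))"
      by (simp only: absv_divide absv_u div_by_1)
    also have "\<dots> < rad"
      using absv_diff_le[of "padic_exp L - 1" "u - 1"] expL u by linarith
    finally show ?thesis .
  qed
  have "absv (padic_log v) \<le> (1 / real p) ^ N" for N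
  proof -
    define P where "P = p ^ N"
    have "0 < P"
      using p_gt_1 by (simp add: P_def)
    let ?P = "of_nat P :: 'k"
    have "absv ((padic_exp (?P * L) - 1 - ?P * L) - (u ^ P - 1 - ?P * L)) \<le> absv ?P ^ 2"
    proof (rule absv_diff_boundI)
      have "absv (padic_exp (?P * L) - 1 - ?P * L) \<le> absv ?P ^ 2 * absv L"
        using L by (intro absv_padic_exp_minus_1_minus_le) simp_all
      also have "\<dots> \<le> absv ?P ^ 2"
        using L rad_less_1 by (simp add: mult_left_le)
      finally show "absv (padic_exp (?P * L) - 1 - ?P * L) \<le> absv ?P ^ 2" .
      show "absv (u ^ P - 1 - ?P * L) \<le> absv ?P ^ 2"
        unfolding L_def by (rule absv_power_minus_1_minus_log_le_square[OF u \<open>0 < P\<close>])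
    qed
    moreover have "v ^ P - 1 = ((padic_exp (?P * L) - 1 - ?P * L) - (u ^ P - 1 - ?P * L)) / u ^ P"
    proof -
      have "x / w - 1 = ((x - 1 - c) - (w - 1 - c)) / w" if "w \<noteq> 0" for x w c :: 'k
        using that by (simp add: field_simps)
      moreover have "u ^ P \<noteq> 0"
        using \<open>u \<noteq> 0\<close> by (rule power_not_zero)
      ultimately show ?thesis
        unfolding v_def power_divide padic_exp_of_nat_mult[OF L] .
    qed
    ultimately have "absv (v ^ P - 1) \<le> absv ?P ^ 2"
      by (simp only: absv_divide absv_power absv_u power_one div_by_1)
    moreover have "absv (v ^ P - 1 - ?P * padic_log v) \<le> absv ?P ^ 2"
      by (rule absv_power_minus_1_minus_log_le_square[OF v \<open>0 < P\<close>])
    ultimately have "absv (v ^ P - 1 - (v ^ P - 1 - ?P * padic_log v)) \<le> absv ?P ^ 2"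
      by (rule absv_diff_boundI)
    moreover have "y - (y - x) = x" for x y :: 'k
      by simp
    ultimately have "absv ?P * absv (padic_log v) \<le> absv ?P * absv ?P"
      by (simp only: absv_mult power2_eq_square)
    moreover have "0 < absv ?P"
      unfolding P_def absv_p_power using p_gt_1 by simp
    ultimately have "absv (padic_log v) \<le> absv ?P"
      by (rule mult_left_le_imp_le)
    then show ?thesis
      by (simp only: P_def absv_p_power)
  qed
  then have "padic_log v = 0"
    by (rule eq_0_if_absv_le_p_powers)
  then have "v = 1"
    by (rule padic_log_eq_0_imp[OF v])
  then show ?thesis
    using \<open>u \<noteq> 0\<close> by (simp only: v_def L_def divide_eq_1_iff)
qed

lemma qpow_of_nat:
  fixes q :: 'k
  assumes q: "absv (q - 1) < rad"
  shows "qpow q (of_nat n) = q ^ n"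
  unfolding qpow_def
  using absv_padic_log_le[OF q] q by (simp add: padic_exp_of_nat_mult padic_exp_log)

lemma qpow_minus_of_nat:
  fixes q :: 'k
  assumes q: "absv (q - 1) < rad"
  shows "qpow q (- of_nat n) = inverse (q ^ n)"
proof -
  have "absv (of_nat n * padic_log q) < rad"
    using absv_padic_log_le[OF q] q by (intro in_disc_mult) auto
  then have "padic_exp (of_nat n * padic_log q + - (of_nat n * padic_log q))
      = padic_exp (of_nat n * padic_log q) * padic_exp (- (of_nat n * padic_log q))"
    by (intro padic_exp_add) simp_all
  then have "q ^ n * qpow q (- of_nat n) = 1"
    using qpow_of_nat[OF q, of n] by (simp add: padic_exp_0 qpow_def)
  from inverse_unique[OF this] show ?thesis
    by (rule sym)
qed

section \<open>Convergence of the Bernoulli integrals\<close>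

text \<open>
  If \<open>q\<^sup>n = 1\<close>, then also \<open>q\<^sup>M = 1\<close> for \<open>M = n p\<^sup>N\<close>, so \<open>M log q\<close> is of
  size at most \<open>\<bar>M\<bar>\<^sup>2\<close> for arbitrarily small \<open>\<bar>M\<bar>\<close>,
  which forces \<open>log q = 0\<close> and hence \<open>q = 1\<close>.
\<close>

lemma not_root_of_unity:
  fixes q :: 'k
  assumes q: "absv (q - 1) < rad" and "q \<noteq> 1" and "0 < n"
  shows "q ^ n \<noteq> 1"
proof
  assume eq: "q ^ n = 1"
  have "absv (padic_log q) \<le> (1 / real p) ^ N" for N
  proof -
    let ?M = "of_nat (n * p ^ N) :: 'k"
    have "0 < n * p ^ N"
      using \<open>0 < n\<close> p_gt_1 by simp
    then have "absv (q ^ (n * p ^ N) - 1 - ?M * padic_log q) \<le> absv ?M ^ 2"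
      by (rule absv_power_minus_1_minus_log_le_square[OF q])
    then have "absv ?M * absv (padic_log q) \<le> absv ?M * absv ?M"
      by (simp add: power_mult eq power2_eq_square flip: absv_mult)
    moreover have "?M \<noteq> 0"
      using \<open>0 < n * p ^ N\<close> by (simp only: of_nat_eq_0_iff)
    then have "0 < absv ?M"
      by (metis absv_eq_0_iff absv_nonneg less_eq_real_def)
    ultimately have "absv (padic_log q) \<le> absv ?M"
      by simp
    also have "absv ?M = absv (of_nat n :: 'k) * (1 / real p) ^ N"
      by (simp add: absv_mult absv_power absv_p)
    also have "\<dots> \<le> (1 / real p) ^ N"
      by (rule mult_left_le_one_le) simp_all
    finally show ?thesis .
  qed
  then have "padic_log q = 0"
    by (rule eq_0_if_absv_le_p_powers)
  then show False
    using padic_log_eq_0_imp[OF q] \<open>q \<noteq> 1\<close> by simp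
qed

lemma convergent_p_power_divide:
  fixes q :: 'k
  assumes q: "absv (q - 1) < rad" and "q \<noteq> 1"
  shows "convergent (\<lambda>N. of_nat (p ^ N) / (1 - q ^ (p ^ N)))"
    and "(\<lambda>N. q ^ (p ^ N)) \<longlonglongrightarrow> 1"
proof -
  let ?P = "\<lambda>N. of_nat (p ^ N) :: 'k"
  have nz: "?P N \<noteq> 0" for N
    using p_gt_1 by auto
  have le: "absv ((q ^ (p ^ N) - 1) / ?P N - padic_log q) \<le> (1 / real p) ^ N" for N
  proof -
    have "(q ^ (p ^ N) - 1) / ?P N - padic_log q = (q ^ (p ^ N) - 1 - ?P N * padic_log q) / ?P N"
      using nz[of N] by (simp add: field_simps)
    also have "absv \<dots> \<le> absv (?P N) ^ 2 / absv (?P N)"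
      unfolding absv_divide using p_gt_1
      by (intro divide_right_mono absv_power_minus_1_minus_log_le_square[OF q]) auto
    also have "\<dots> = (1 / real p) ^ N"
      unfolding absv_p_power using p_gt_1 by (simp add: power2_eq_square)
    finally show ?thesis .
  qed
  have quot: "(\<lambda>N. (q ^ (p ^ N) - 1) / ?P N) \<longlonglongrightarrow> padic_log q"
    using p_power_tendsto_0 le by (rule tendsto_nonarchI)
  have "padic_log q \<noteq> 0"
    using padic_log_eq_0_imp[OF q] \<open>q \<noteq> 1\<close> by auto
  from tendsto_minus[OF tendsto_inverse_nonarch[OF quot this]]
  have "(\<lambda>N. - inverse ((q ^ (p ^ N) - 1) / ?P N)) \<longlonglongrightarrow> - inverse (padic_log q)" .
  moreover have "- inverse ((q ^ (p ^ N) - 1) / ?P N) = ?P N / (1 - q ^ (p ^ N))" for N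
    by (metis inverse_divide minus_diff_eq minus_divide_right)
  ultimately show "convergent (\<lambda>N. ?P N / (1 - q ^ (p ^ N)))"
    by (auto simp: convergent_def)
  have "?P \<longlonglongrightarrow> 0"
    unfolding tendsto_absv_iff[of _ 0] using p_power_tendsto_0 by (simp add: absv_p_power del: of_nat_power)
  from tendsto_add[OF tendsto_mult[OF this quot] tendsto_const[of 1]]
  have "(\<lambda>N. ?P N * ((q ^ (p ^ N) - 1) / ?P N) + 1) \<longlonglongrightarrow> 1"
    by simp
  then show "(\<lambda>N. q ^ (p ^ N)) \<longlonglongrightarrow> 1"
    by (simp only: times_divide_eq_right nonzero_mult_div_cancel_left[OF nz] diff_add_cancel)
qed

text \<open>
  For \<open>j > 0\<close> and \<open>y = q\<close> to the power \<open>p\<^sup>N\<close>, the quotient is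
  \<open>(1 - y\<^sup>j) / (1 - y) = 1 + y + \<dots>\<close> divided by \<open>1 - q\<^sup>j\<close>, which has a limit as
  \<open>y\<close> tends to \<open>1\<close>. Only \<open>j = 0\<close> involves the logarithm.
\<close>

lemma convergent_geometric_mean:
  fixes q :: 'k
  assumes q: "absv (q - 1) < rad" and "q \<noteq> 1"
  shows "convergent (\<lambda>N. (\<Sum>i<p ^ N. (q ^ j) ^ i) / (1 - q ^ (p ^ N)))"
proof (cases "j = 0")
  case True
  then show ?thesis
    using convergent_p_power_divide(1)[OF assms] by simp
next
  case False
  let ?y = "\<lambda>N. q ^ (p ^ N)"
  have "(\<Sum>i<p ^ N. (q ^ j) ^ i) / (1 - ?y N) = inverse (1 - q ^ j) * (\<Sum>k<j. ?y N ^ k)" for N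
  proof -
    have "q ^ j \<noteq> 1" and "?y N \<noteq> 1"
      using False p_gt_1 by (auto intro!: not_root_of_unity[OF assms])
    moreover have "(q ^ j) ^ p ^ N = ?y N ^ j"
      by (simp add: power_mult[symmetric] mult.commute)
    ultimately show ?thesis
      by (simp add: sum_gp_strict field_simps)
  qed
  moreover have "(\<lambda>N. inverse (1 - q ^ j) * (\<Sum>k<j. ?y N ^ k))
      \<longlonglongrightarrow> inverse (1 - q ^ j) * (\<Sum>k<j. 1 ^ k)"
    by (intro tendsto_mult tendsto_const tendsto_sum tendsto_power_strong
        convergent_p_power_divide(2)[OF assms])
  ultimately show ?thesis
    by (auto simp: convergent_def)
qed

text \<open>
  The \<open>N\<close>-th approximation to the integral defining \<open>\<beta>\<^sub>m(q)\<close>, with the weights cancelled and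
  \<open>q\<^sup>x\<close> replaced by ordinary powers. The leading factor is \<open>1 / [p\<^sup>N]\<close>.
\<close>

definition bracket_moment :: "'k \<Rightarrow> nat \<Rightarrow> nat \<Rightarrow> 'k" where
  "bracket_moment q m N = (1 - q) / (1 - q ^ (p ^ N)) * (\<Sum>i<p ^ N. ((1 - q ^ i) / (1 - q)) ^ m)"

lemma convergent_bracket_moment:
  fixes q :: 'k
  assumes q: "absv (q - 1) < rad" and "q \<noteq> 1"
  shows "convergent (bracket_moment q m)"
proof -
  obtain l where l: "\<And>j. (\<lambda>N. (\<Sum>i<p ^ N. (q ^ j) ^ i) / (1 - q ^ (p ^ N))) \<longlonglongrightarrow> l j"
    using convergent_geometric_mean[OF assms] unfolding convergent_def by metis
  define c where "c j = (1 - q) / (1 - q) ^ m * (of_nat (m choose j) * (- 1) ^ j)" for j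
  have mean: "bracket_moment q m N
      = (\<Sum>j\<le>m. c j * ((\<Sum>i<p ^ N. (q ^ j) ^ i) / (1 - q ^ (p ^ N))))" for N
  proof -
    have "((1 - q ^ i) / (1 - q)) ^ m
        = (\<Sum>j\<le>m. of_nat (m choose j) * (- 1) ^ j * (q ^ j) ^ i) / (1 - q) ^ m" for i
    proof -
      have "(1 - q ^ i) ^ m = (- (q ^ i) + 1) ^ m"
        by simp
      also have "\<dots> = (\<Sum>j\<le>m. of_nat (m choose j) * (- (q ^ i)) ^ j)"
        unfolding binomial_ring by simp
      also have "\<dots> = (\<Sum>j\<le>m. of_nat (m choose j) * (- 1) ^ j * (q ^ j) ^ i)"
        by (rule sum.cong) (simp_all add: power_minus[of "q ^ i"] mult.assoc mult.commute flip: power_mult)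
      finally show ?thesis
        by (simp add: power_divide)
    qed
    then have "bracket_moment q m N = (1 - q) / (1 - q ^ (p ^ N)) / (1 - q) ^ m
        * (\<Sum>i<p ^ N. \<Sum>j\<le>m. of_nat (m choose j) * (- 1) ^ j * (q ^ j) ^ i)"
      by (simp add: bracket_moment_def flip: sum_divide_distrib)
    also have "\<dots> = (\<Sum>j\<le>m. (1 - q) / (1 - q ^ (p ^ N)) / (1 - q) ^ m
        * (\<Sum>i<p ^ N. of_nat (m choose j) * (- 1) ^ j * (q ^ j) ^ i))"
      by (subst sum.swap) (rule sum_distrib_left)
    also have "\<dots> = (\<Sum>j\<le>m. c j * ((\<Sum>i<p ^ N. (q ^ j) ^ i) / (1 - q ^ (p ^ N))))"
      by (rule sum.cong) (simp_all add: c_def field_simps flip: sum_distrib_left)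
    finally show ?thesis .
  qed
  have "(\<lambda>N. \<Sum>j\<le>m. c j * ((\<Sum>i<p ^ N. (q ^ j) ^ i) / (1 - q ^ (p ^ N))))
      \<longlonglongrightarrow> (\<Sum>j\<le>m. c j * l j)"
    by (intro tendsto_sum tendsto_mult tendsto_const l)
  then have "(\<lambda>N. bracket_moment q m N) \<longlonglongrightarrow> (\<Sum>j\<le>m. c j * l j)"
    by (simp only: mean)
  then show ?thesis
    by (auto simp: convergent_def)
qed

lemma qbernoulli_tendsto:
  fixes q :: 'k
  assumes q: "absv (q - 1) < rad" and "q \<noteq> 1"
  shows "bracket_moment q m \<longlonglongrightarrow> qbernoulli p q m"
proof -
  have "q \<noteq> 0"
    using q rad_less_1 by auto
  then have "1 / qbracket q (of_nat (p ^ N)) *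
      (\<Sum>i<p ^ N. q ^ i * (qpow q (- of_nat i) * qbracket q (of_nat i) ^ m)) = bracket_moment q m N" for N
    by (simp add: qpow_minus_of_nat[OF q] qpow_of_nat[OF q] qbracket_def bracket_moment_def
        mult.assoc[symmetric] del: of_nat_power)
  then have "qbernoulli p q m = lim (bracket_moment q m)"
    by (simp add: qbernoulli_def volkenborn_Zp_def del: of_nat_power)
  then show ?thesis
    using convergent_bracket_moment[OF assms] by (simp add: convergent_LIMSEQ_iff)
qed

section \<open>Removing the multiples of \<open>p\<close>\<close>

lemma sum_multiples:
  fixes f :: "nat \<Rightarrow> 'k"
  shows "(\<Sum>i | i < p ^ Suc N \<and> p dvd i. f i) = (\<Sum>j<p ^ N. f (p * j))"
proof -
  have "{i. i < p ^ Suc N \<and> p dvd i} = (*) p ` {..<p ^ N}"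
    using p_gt_1 by (auto simp: dvd_def)
  moreover have "inj_on ((*) p) {..<p ^ N}"
    using p_gt_1 by (intro inj_onI) simp
  ultimately show ?thesis
    by (simp add: sum.reindex)
qed

text \<open>
  The multiples of \<open>p\<close> carry a factor \<open>[p]\<^sup>m\<close>; one power of \<open>[p]\<close> is used up in passing from
  the normalisation \<open>1 / [p\<^sup>N\<^sup>+\<^sup>1 : q]\<close> to \<open>1 / [p\<^sup>N : q\<^sup>p]\<close>.
\<close>

lemma bracket_moment_without_multiples:
  fixes q :: 'k
  assumes qp: "q ^ p \<noteq> 1" and "0 < m"
  shows "(1 - q) / (1 - q ^ p ^ Suc N)
        * (\<Sum>i | i < p ^ Suc N \<and> \<not> p dvd i. ((1 - q ^ i) / (1 - q)) ^ m)
      = bracket_moment q m (Suc N) - ((1 - q ^ p) / (1 - q)) ^ (m - 1) * bracket_moment (q ^ p) m N"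
proof -
  let ?f = "\<lambda>i. ((1 - q ^ i) / (1 - q)) ^ m"
  have "q \<noteq> 1"
    using qp by auto
  have "{..<p ^ Suc N} - {i. i < p ^ Suc N \<and> p dvd i} = {i. i < p ^ Suc N \<and> \<not> p dvd i}"
    by auto
  then have "(\<Sum>i | i < p ^ Suc N \<and> \<not> p dvd i. ?f i)
      = (\<Sum>i<p ^ Suc N. ?f i) - (\<Sum>i | i < p ^ Suc N \<and> p dvd i. ?f i)"
    using sum_diff[of "{..<p ^ Suc N}" "{i. i < p ^ Suc N \<and> p dvd i}" ?f] by auto
  also have "(\<Sum>i | i < p ^ Suc N \<and> p dvd i. ?f i)
      = (\<Sum>j<p ^ N. ((1 - q ^ p) / (1 - q)) ^ m * ((1 - (q ^ p) ^ j) / (1 - q ^ p)) ^ m)"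
    unfolding sum_multiples
  proof (rule sum.cong[OF refl])
    fix j
    have "(1 - q ^ (p * j)) / (1 - q) = (1 - q ^ p) / (1 - q) * ((1 - (q ^ p) ^ j) / (1 - q ^ p))"
      using qp by (simp add: power_mult)
    then show "?f (p * j) = ((1 - q ^ p) / (1 - q)) ^ m * ((1 - (q ^ p) ^ j) / (1 - q ^ p)) ^ m"
      by (simp only: power_mult_distrib)
  qed
  also have "\<dots> = ((1 - q ^ p) / (1 - q)) ^ (m - 1) * ((1 - q ^ p) / (1 - q))
      * (\<Sum>j<p ^ N. ((1 - (q ^ p) ^ j) / (1 - q ^ p)) ^ m)"
    using \<open>0 < m\<close> by (simp only: sum_distrib_left[symmetric] power_minus_mult)
  finally have sums: "(\<Sum>i | i < p ^ Suc N \<and> \<not> p dvd i. ?f i) = (\<Sum>i<p ^ Suc N. ?f i)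
      - ((1 - q ^ p) / (1 - q)) ^ (m - 1) * ((1 - q ^ p) / (1 - q))
        * (\<Sum>j<p ^ N. ((1 - (q ^ p) ^ j) / (1 - q ^ p)) ^ m)" .
  have "a / d * (x - r * (b / a) * y) = a / d * x - r * (b / d * y)" if "a \<noteq> 0" for a b d r x y :: 'k
    using that by (cases "d = 0") (simp_all add: field_simps)
  moreover have "(q ^ p) ^ p ^ N = q ^ p ^ Suc N"
    by (simp add: power_mult)
  ultimately show ?thesis
    unfolding sums bracket_moment_def using \<open>q \<noteq> 1\<close> by simp
qed

end

theorem proposition2:
  fixes p n :: nat and q :: "'k::complete_nonarch_field"
  assumes "prime p"
    and "is_Cp p TYPE('k)"
    and "q \<noteq> 1"
    and "absv (q - 1) < real p powr (- 1 / (real p - 1))"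
    and "n > 0"
  shows "padic_qzeta0 p q (of_nat n) =
    1 / (of_nat ((p - 1) * n)) *
      (qbernoulli p q ((p - 1) * n)
       - qbracket q (of_nat p) ^ ((p - 1) * n - 1) * qbernoulli p (q ^ p) ((p - 1) * n))"
proof -
  interpret padic_nonarch_field p "TYPE('k)"
    using assms(2) by unfold_locales (simp_all add: is_Cp_def)
  have q: "absv (q - 1) < rad"
    using assms(4) by (simp add: rad_def)
  have "absv q = 1"
    using q rad_less_1 by (intro absv_eq_1_if_near_1) linarith
  then have qp: "absv (q ^ p - 1) < rad"
    using absv_power_minus_1_le[of q p] q by simp
  have qp_ne: "q ^ p \<noteq> 1"
    using p_gt_1 by (intro not_root_of_unity[OF q \<open>q \<noteq> 1\<close>]) simp
  define m where "m = (p - 1) * n"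
  have "0 < m"
    using p_gt_1 \<open>n > 0\<close> by (simp add: m_def)
  define T where "T N = 1 / qbracket q (of_nat (p ^ N)) * (\<Sum>i \<in> {i. i < p ^ N \<and> \<not> p dvd i}.
      q ^ i * (qpow q (- of_nat i) * pow_mult (qbracket q (of_nat i)) (p - 1) (of_nat n)))" for N
  have "q \<noteq> 0"
    using \<open>absv q = 1\<close> by auto
  have T: "T N = (1 - q) / (1 - q ^ p ^ N)
      * (\<Sum>i | i < p ^ N \<and> \<not> p dvd i. ((1 - q ^ i) / (1 - q)) ^ m)" for N
    using \<open>q \<noteq> 0\<close>
    by (simp add: T_def pow_mult_def qpow_minus_of_nat[OF q] qpow_of_nat[OF q] qbracket_def
        m_def mult.assoc[symmetric] del: of_nat_power)
  have bracket: "qbracket q (of_nat p) = (1 - q ^ p) / (1 - q)"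
    by (simp add: qbracket_def qpow_of_nat[OF q])
  have "(\<lambda>N. T (Suc N)) \<longlonglongrightarrow> qbernoulli p q m - qbracket q (of_nat p) ^ (m - 1) * qbernoulli p (q ^ p) m"
    unfolding T bracket_moment_without_multiples[OF qp_ne \<open>0 < m\<close>] bracket
  proof -
    have "(\<lambda>N. bracket_moment q m (Suc N)
          + - (((1 - q ^ p) / (1 - q)) ^ (m - 1) * bracket_moment (q ^ p) m N))
        \<longlonglongrightarrow> qbernoulli p q m + - (((1 - q ^ p) / (1 - q)) ^ (m - 1) * qbernoulli p (q ^ p) m)"
      by (intro tendsto_add tendsto_minus tendsto_mult tendsto_const LIMSEQ_Suc
          qbernoulli_tendsto q qp qp_ne \<open>q \<noteq> 1\<close>)
    then show "(\<lambda>N. bracket_moment q m (Suc N)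
          - ((1 - q ^ p) / (1 - q)) ^ (m - 1) * bracket_moment (q ^ p) m N)
        \<longlonglongrightarrow> qbernoulli p q m - ((1 - q ^ p) / (1 - q)) ^ (m - 1) * qbernoulli p (q ^ p) m"
      by simp
  qed
  then have "T \<longlonglongrightarrow> qbernoulli p q m - qbracket q (of_nat p) ^ (m - 1) * qbernoulli p (q ^ p) m"
    by (rule LIMSEQ_imp_Suc)
  then have "volkenborn_Tp p q (\<lambda>x. qpow q (- x) * pow_mult (qbracket q x) (p - 1) (of_nat n))
      = qbernoulli p q m - qbracket q (of_nat p) ^ (m - 1) * qbernoulli p (q ^ p) m"
    unfolding volkenborn_Tp_def T_def[abs_def, symmetric] by (rule limI)
  then show ?thesis
    by (simp add: padic_qzeta0_def m_def)
qed

end
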